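(* Let $G$ be a graph of order $n$ with $\chi_D(G)=n$. Then $\chi_D(G\cup G)=n+1$ if $G\cong K_n$; $\chi_D(G\cup G)=2n$ if $G\cong\overline{K_n}$; and $\chi_D(G\cup G)=n$ otherwise.
   Context: $G\cup G$ is the disjoint union of two copies of $G$. A distinguishing $k$-coloring of a graph is a partition of its vertex set into exactly $k$ non-empty independent sets such that the only automorphism mapping every class onto itself is the identity; $\chi_D$ is the least such $k$. $\overline{K_n}$ is the edgeless graph on $n$ vertices. *)

theory Defs
  imports
    "HOL-Library.Disjoint_Sets"
    "HOL-Combinatorics.Permutations"
    "Graph_Theory.Pair_Digraph"
    "Graph_Theory.Digraph_Isomorphism"
begin

text \<open>
  Finite simple graphs are the structures satisfying \<^locale>\<open>pair_graph\<close>: a finite vertex set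
  together with a symmetric, irreflexive adjacency relation, so that each edge
  \<open>{u, v}\<close> is represented by the two arcs \<open>(u, v)\<close> and \<open>(v, u)\<close>.
\<close>

definition complete_graph :: "nat \<Rightarrow> nat pair_pre_digraph" where
  "complete_graph n = \<lparr>pverts = {..<n}, parcs = {(u, v). u < n \<and> v < n \<and> u \<noteq> v}\<rparr>"

definition edgeless_graph :: "nat \<Rightarrow> nat pair_pre_digraph" where
  "edgeless_graph n = \<lparr>pverts = {..<n}, parcs = {}\<rparr>"

definition disjoint_union ::
    "'a pair_pre_digraph \<Rightarrow> 'b pair_pre_digraph \<Rightarrow> ('a + 'b) pair_pre_digraph" where
  "disjoint_union G H =
     \<lparr>pverts = pverts G <+> pverts H,
      parcs = map_prod Inl Inl ` parcs G \<union> map_prod Inr Inr ` parcs H\<rparr>"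

definition graph_isomorphic :: "'a pair_pre_digraph \<Rightarrow> 'b pair_pre_digraph \<Rightarrow> bool" where
  "graph_isomorphic G H \<longleftrightarrow> digraph_iso (with_proj G) (with_proj H)"

text \<open>
  A permutation in the sense of \<^const>\<open>permutes\<close> fixes everything outside the vertex set,
  so the trivial automorphism is exactly \<^const>\<open>id\<close>.
\<close>

definition graph_automorphism :: "'a pair_pre_digraph \<Rightarrow> ('a \<Rightarrow> 'a) \<Rightarrow> bool" where
  "graph_automorphism G \<pi> \<longleftrightarrow> \<pi> permutes pverts G \<and>
     (\<forall>u\<in>pverts G. \<forall>v\<in>pverts G. (\<pi> u, \<pi> v) \<in> parcs G \<longleftrightarrow> (u, v) \<in> parcs G)"

definition independent_vertices :: "'a pair_pre_digraph \<Rightarrow> 'a set \<Rightarrow> bool" where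
  "independent_vertices G S \<longleftrightarrow> S \<subseteq> pverts G \<and> (\<forall>u\<in>S. \<forall>v\<in>S. (u, v) \<notin> parcs G)"

text \<open>
  A coloring is given by its set \<open>P\<close> of color classes; \<^const>\<open>partition_on\<close> makes the classes
  non-empty.
\<close>

definition distinguishing_coloring :: "'a pair_pre_digraph \<Rightarrow> nat \<Rightarrow> 'a set set \<Rightarrow> bool" where
  "distinguishing_coloring G k P \<longleftrightarrow>
     partition_on (pverts G) P \<and> finite P \<and> card P = k \<and>
     (\<forall>S\<in>P. independent_vertices G S) \<and>
     (\<forall>\<pi>. graph_automorphism G \<pi> \<and> (\<forall>S\<in>P. \<pi> ` S = S) \<longrightarrow> \<pi> = id)"

text \<open>
  For finite simple graphs the minimum is attained, since the partition into singletons is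
  a distinguishing coloring.
\<close>

definition distinguishing_chromatic_number :: "'a pair_pre_digraph \<Rightarrow> nat" (\<open>\<chi>\<^sub>D\<close>) where
  "\<chi>\<^sub>D G = (LEAST k. \<exists>P. distinguishing_coloring G k P)"

lemma (in pair_graph) distinguishing_coloring_singletons:
  "distinguishing_coloring G (card (pverts G)) ((\<lambda>v. {v}) ` pverts G)"
proof -
  have "\<pi> = id" if "graph_automorphism G \<pi>" "\<forall>v\<in>pverts G. \<pi> v = v" for \<pi>
    using that by (fastforce simp: graph_automorphism_def permutes_def)
  moreover have "partition_on (pverts G) ((\<lambda>v. {v}) ` pverts G)"
    by (auto simp: partition_on_def disjoint_def)
  moreover have "card ((\<lambda>v. {v}) ` pverts G) = card (pverts G)"
    by (rule card_image) (auto simp: inj_on_def)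
  ultimately show ?thesis
    using pair_finite_verts pair_no_loops
    by (fastforce simp: distinguishing_coloring_def independent_vertices_def)
qed

end

theory Submission
  imports Defs
begin

text \<open>
  If \<open>\<chi>\<^sub>D G = |V(G)|\<close>, then any two distinct non-adjacent vertices have the same
  neighbours: otherwise they could share a color class while all other vertices are singletons.
  So \<open>G\<close> is complete multipartite. If \<open>G\<close> is neither complete nor edgeless, choose \<open>a\<close>, \<open>b\<close>, \<open>c\<close>
  with \<open>a\<close> adjacent to \<open>c\<close> but not to \<open>b\<close>, color both copies of \<open>G\<close> with the same \<open>n\<close>
  colors, each used once per copy, but interchange \<open>b\<close> and \<open>c\<close> in the second copy. A
  color-preserving automorphism exchanging the copies would make the transposition of \<open>b\<close> and
  \<open>c\<close> an automorphism of \<open>G\<close>, which it is not. If \<open>G\<close> is complete, an \<open>n\<close>-coloring of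
  \<open>G \<union> G\<close> uses every color exactly once in each copy, so exchanging the copies along the colors is
  an automorphism, and one extra color used on a single vertex destroys it.
\<close>

section \<open>Colorings as labellings\<close>

text \<open>Explicit colorings are easier to handle as functions than as partitions: classes become
  fibres, the number of colors becomes the size of the image of \<open>pverts G\<close>, and
  preserving every class becomes the pointwise equation \<open>c (\<pi> v) = c v\<close>. The color
  type \<open>'c\<close> is free, so each construction can use the colors that suit it.\<close>

definition distinguishing_labelling :: "'a pair_pre_digraph \<Rightarrow> ('a \<Rightarrow> 'c) \<Rightarrow> bool" where
  "distinguishing_labelling G c \<longleftrightarrow>
     (\<forall>(u, v)\<in>parcs G. c u \<noteq> c v) \<and>
     (\<forall>\<pi>. graph_automorphism G \<pi> \<and> (\<forall>v\<in>pverts G. c (\<pi> v) = c v) \<longrightarrow> \<pi> = id)"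

lemma distinguishing_labelling_proper:
  "distinguishing_labelling G c \<Longrightarrow> (u, v) \<in> parcs G \<Longrightarrow> c u \<noteq> c v"
  by (auto simp: distinguishing_labelling_def)

lemma distinguishing_labelling_rigid:
  "distinguishing_labelling G c \<Longrightarrow> graph_automorphism G \<pi> \<Longrightarrow>
    (\<And>v. v \<in> pverts G \<Longrightarrow> c (\<pi> v) = c v) \<Longrightarrow> \<pi> = id"
  by (auto simp: distinguishing_labelling_def)

text \<open>Rigidity needs checking on vertices only, because \<open>permutes\<close> already makes
  an automorphism the identity elsewhere.\<close>

lemma distinguishing_labellingI:
  assumes "\<And>u v. (u, v) \<in> parcs G \<Longrightarrow> c u \<noteq> c v"
    and "\<And>\<pi> v. graph_automorphism G \<pi> \<Longrightarrow> (\<And>u. u \<in> pverts G \<Longrightarrow> c (\<pi> u) = c u)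
           \<Longrightarrow> v \<in> pverts G \<Longrightarrow> \<pi> v = v"
  shows "distinguishing_labelling G c"
proof -
  have "\<pi> = id" if "graph_automorphism G \<pi>" "\<forall>u\<in>pverts G. c (\<pi> u) = c u" for \<pi>
  proof
    fix v
    show "\<pi> v = id v"
      using assms(2)[of \<pi> v] that by (auto simp: graph_automorphism_def permutes_def)
  qed
  then show ?thesis
    using assms(1) by (auto simp: distinguishing_labelling_def)
qed

lemma graph_automorphism_in_verts:
  "graph_automorphism G \<pi> \<Longrightarrow> v \<in> pverts G \<Longrightarrow> \<pi> v \<in> pverts G"
  by (auto simp: graph_automorphism_def permutes_in_image)

lemma graph_automorphism_eq_iff:
  "graph_automorphism G \<pi> \<Longrightarrow> \<pi> u = \<pi> v \<longleftrightarrow> u = v"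
  by (metis graph_automorphism_def permutes_def)

lemma graph_automorphism_arcs_iff:
  "graph_automorphism G \<pi> \<Longrightarrow> u \<in> pverts G \<Longrightarrow> v \<in> pverts G \<Longrightarrow>
    (\<pi> u, \<pi> v) \<in> parcs G \<longleftrightarrow> (u, v) \<in> parcs G"
  by (auto simp: graph_automorphism_def)

lemma ex_distinguishing_coloring:
  assumes "finite (pverts G)" and "distinguishing_labelling G c"
  shows "\<exists>P. distinguishing_coloring G (card (c ` pverts G)) P"
proof -
  \<comment> \<open>The classes are the fibres of \<open>c\<close> over attained colors, hence
    non-empty and as many as there are colors in use.\<close>
  define cls where "cls = (\<lambda>x. {v \<in> pverts G. c v = x})"
  let ?P = "cls ` c ` pverts G"
  have "partition_on (pverts G) ?P"
    by (auto simp: partition_on_def disjoint_def cls_def)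
  moreover have "card ?P = card (c ` pverts G)"
    by (rule card_image) (auto simp: inj_on_def cls_def)
  moreover have "independent_vertices G S" if "S \<in> ?P" for S
    using that distinguishing_labelling_proper[OF assms(2)]
    by (fastforce simp: independent_vertices_def cls_def)
  moreover have "\<pi> = id" if "graph_automorphism G \<pi>" and fix_cls: "\<forall>S\<in>?P. \<pi> ` S = S" for \<pi>
  proof (rule distinguishing_labelling_rigid[OF assms(2) that(1)])
    fix v assume "v \<in> pverts G"
    then have "\<pi> v \<in> \<pi> ` cls (c v)" and "cls (c v) \<in> ?P"
      by (auto simp: cls_def)
    then have "\<pi> v \<in> cls (c v)"
      using fix_cls by blast
    then show "c (\<pi> v) = c v"
      by (simp add: cls_def)
  qed
  ultimately have "distinguishing_coloring G (card (c ` pverts G)) ?P"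
    using assms(1) by (simp only: distinguishing_coloring_def) simp
  then show ?thesis ..
qed

text \<open>The color of a vertex is the class containing it, so the set of colors in use is
  \<open>P\<close> itself. Well-formedness places the ends of every arc in the vertex set, where
  this labelling is determined.\<close>

lemma distinguishing_coloring_imp_labelling:
  assumes col: "distinguishing_coloring G k P" and wf: "pair_wf_digraph G"
  shows "\<exists>c :: 'a \<Rightarrow> 'a set. distinguishing_labelling (G :: 'a pair_pre_digraph) c
           \<and> card (c ` pverts G) = k"
proof -
  interpret pair_wf_digraph G by (rule wf)
  have part: "partition_on (pverts G) P"
    using col by (simp add: distinguishing_coloring_def)
  define c where "c = (\<lambda>v. THE S. S \<in> P \<and> v \<in> S)"
  have c_eq: "c v = S" if "v \<in> S" "S \<in> P" for v S
    unfolding c_def using that part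
    by (intro the_equality) (auto dest: partition_onD2 disjointD)
  have c_in: "c v \<in> P" "v \<in> c v" if "v \<in> pverts G" for v
    using that partition_onD1[OF part] c_eq by auto
  have "c ` pverts G = P"
  proof
    show "P \<subseteq> c ` pverts G"
    proof
      fix S assume "S \<in> P"
      moreover then obtain v where "v \<in> S"
        using partition_onD3[OF part] by fastforce
      ultimately show "S \<in> c ` pverts G"
        using partition_onD1[OF part] c_eq by blast
    qed
  qed (use c_in in auto)
  moreover have "distinguishing_labelling G c"
  proof -
    have "c u \<noteq> c v" if "(u, v) \<in> parcs G" for u v
    proof
      assume "c u = c v"
      then have "u \<in> c v" "v \<in> c v" "c v \<in> P"
        using that c_in in_arcsD1 in_arcsD2 by metis+
      then show False
        using that col by (auto simp: distinguishing_coloring_def independent_vertices_def)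
    qed
    moreover have "\<pi> = id"
      if aut: "graph_automorphism G \<pi>" and pres: "\<forall>v\<in>pverts G. c (\<pi> v) = c v" for \<pi>
    proof -
      have "\<pi> ` S = S" if "S \<in> P" for S
      proof -
        have S: "S = {v \<in> pverts G. c v = S}"
          using that c_eq c_in partition_onD1[OF part] by blast
        have bij: "\<pi> permutes pverts G"
          using aut by (simp add: graph_automorphism_def)
        have "\<pi> ` {v \<in> pverts G. c v = S} = {v \<in> pverts G. c v = S}"
        proof
          \<comment> \<open>A preimage of \<open>w\<close> under \<pi> has the same label as
            \<open>w\<close>, so it lies in the same fibre; hence \<pi> maps the fibre onto itself
            and not merely into itself.\<close>
          show "{v \<in> pverts G. c v = S} \<subseteq> \<pi> ` {v \<in> pverts G. c v = S}"
          proof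
            fix w assume w: "w \<in> {v \<in> pverts G. c v = S}"
            then obtain v where "v \<in> pverts G" "w = \<pi> v"
              using permutes_image[OF bij] by blast
            then show "w \<in> \<pi> ` {v \<in> pverts G. c v = S}"
              using w pres by auto
          qed
        qed (use pres graph_automorphism_in_verts[OF aut] in auto)
        then show ?thesis
          using S by simp
      qed
      then show ?thesis
        using col aut by (simp add: distinguishing_coloring_def)
    qed
    ultimately show ?thesis
      by (auto simp: distinguishing_labelling_def)
  qed
  ultimately show ?thesis
    using col by (auto simp: distinguishing_coloring_def)
qed

lemma distinguishing_chromatic_number_le:
  "finite (pverts G) \<Longrightarrow> distinguishing_labelling G c \<Longrightarrow> \<chi>\<^sub>D G \<le> card (c ` pverts G)"
  unfolding distinguishing_chromatic_number_def
  by (rule Least_le) (rule ex_distinguishing_coloring)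

lemma (in pair_graph) distinguishing_chromatic_number_attained:
  obtains c :: "'a \<Rightarrow> 'a set"
  where "distinguishing_labelling G c" and "card (c ` pverts G) = \<chi>\<^sub>D G"
proof -
  have "\<exists>P. distinguishing_coloring G (\<chi>\<^sub>D G) P"
    unfolding distinguishing_chromatic_number_def
    by (rule LeastI_ex) (use distinguishing_coloring_singletons in blast)
  then show thesis
    using distinguishing_coloring_imp_labelling pair_wf_digraph that by blast
qed

lemma (in pair_graph) arcs_commute: "(u, v) \<in> parcs G \<longleftrightarrow> (v, u) \<in> parcs G"
  using pair_sym_arcs by (auto simp: symmetric_def dest: symD)

section \<open>Isomorphism to complete and edgeless graphs\<close>

text \<open>A \<open>digraph_iso\<close> carries separate maps for vertices, arcs, tails and heads.
  Since an arc of a pair digraph is the pair of its ends, the vertex map forces the arc map to be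
  \<open>map_prod f f\<close>, and only a bijection of vertices remains.\<close>

lemma graph_isomorphic_iff:
  assumes "pair_wf_digraph G"
  shows "graph_isomorphic G H \<longleftrightarrow>
    (\<exists>f. bij_betw f (pverts G) (pverts H) \<and> map_prod f f ` parcs G = parcs H)"
proof
  assume "graph_isomorphic G H"
  then obtain h where h: "pre_digraph.digraph_isomorphism (with_proj G) h"
    and H: "with_proj H = app_iso h (with_proj G)"
    by (auto simp: graph_isomorphic_def digraph_iso_def)
  have "pverts H = iso_verts h ` pverts G" "parcs H = iso_arcs h ` parcs G"
    "iso_tail h = fst" "iso_head h = snd"
    using H by (simp_all add: with_proj_def app_iso_def)
  moreover from this have "iso_arcs h e = map_prod (iso_verts h) (iso_verts h) e" if "e \<in> parcs G" for e
    using h that by (cases e) (fastforce simp: pre_digraph.digraph_isomorphism_def prod_eq_iff)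
  ultimately show "\<exists>f. bij_betw f (pverts G) (pverts H) \<and> map_prod f f ` parcs G = parcs H"
    using h
    by (intro exI[of _ "iso_verts h"])
      (auto simp: pre_digraph.digraph_isomorphism_def bij_betw_def image_def)
next
  assume "\<exists>f. bij_betw f (pverts G) (pverts H) \<and> map_prod f f ` parcs G = parcs H"
  then obtain f where f: "bij_betw f (pverts G) (pverts H)" "map_prod f f ` parcs G = parcs H"
    by blast
  interpret pair_wf_digraph G by (rule assms)
  define h where "h = \<lparr>iso_verts = f, iso_arcs = map_prod f f, iso_head = snd, iso_tail = fst\<rparr>"
  \<comment> \<open>\<open>f\<close> is injective on vertices only; well-formedness transfers this
    to arcs, as they are pairs of vertices.\<close>
  have "inj_on (map_prod f f) (pverts G \<times> pverts G)"
    using f(1) by (intro map_prod_inj_on) (auto simp: bij_betw_def)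
  then have "inj_on (map_prod f f) (parcs G)"
    by (rule inj_on_subset) (auto dest: in_arcsD1 in_arcsD2)
  moreover have "wf_digraph (with_proj G)"
    using assms by (simp add: wf_digraph_wp_iff)
  ultimately have "pre_digraph.digraph_isomorphism (with_proj G) h"
    using f(1) by (auto simp: pre_digraph.digraph_isomorphism_def h_def bij_betw_def)
  moreover have "with_proj H = app_iso h (with_proj G)"
    using f by (auto simp: with_proj_def app_iso_def h_def bij_betw_def)
  ultimately show "graph_isomorphic G H"
    unfolding graph_isomorphic_def digraph_iso_def by blast
qed

text \<open>This turns the case distinction into a condition on the arcs of \<open>G\<close>. In the
  converse direction any enumeration of the vertices works, since in both graphs the arcs are all
  pairs of distinct vertices.\<close>

lemma (in pair_graph) graph_isomorphic_complete_iff: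
  "graph_isomorphic G (complete_graph (card (pverts G))) \<longleftrightarrow>
    (\<forall>u\<in>pverts G. \<forall>v\<in>pverts G. u \<noteq> v \<longrightarrow> (u, v) \<in> parcs G)"
proof
  assume "graph_isomorphic G (complete_graph (card (pverts G)))"
  then obtain f where f: "bij_betw f (pverts G) {..<card (pverts G)}"
    and arcs: "map_prod f f ` parcs G = parcs (complete_graph (card (pverts G)))"
    by (auto simp: graph_isomorphic_iff[OF pair_wf_digraph] complete_graph_def)
  show "\<forall>u\<in>pverts G. \<forall>v\<in>pverts G. u \<noteq> v \<longrightarrow> (u, v) \<in> parcs G"
  proof (intro ballI impI)
    fix u v assume uv: "u \<in> pverts G" "v \<in> pverts G" "u \<noteq> v"
    then have "(f u, f v) \<in> map_prod f f ` parcs G"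
      using f unfolding arcs by (auto simp: complete_graph_def bij_betw_def dest: inj_onD)
    then obtain x y where "(x, y) \<in> parcs G" "f x = f u" "f y = f v"
      by auto
    then show "(u, v) \<in> parcs G"
      using f uv in_arcsD1 in_arcsD2 by (metis bij_betw_def inj_onD)
  qed
next
  assume complete: "\<forall>u\<in>pverts G. \<forall>v\<in>pverts G. u \<noteq> v \<longrightarrow> (u, v) \<in> parcs G"
  obtain f where f: "bij_betw f (pverts G) {..<card (pverts G)}"
    using ex_bij_betw_finite_nat[OF pair_finite_verts] by (auto simp: atLeast0LessThan)
  have "parcs G = {(u, v). u \<in> pverts G \<and> v \<in> pverts G \<and> u \<noteq> v}"
    using complete by (auto dest: in_arcsD1 in_arcsD2 no_loops')
  moreover have "map_prod f f ` {(u, v). u \<in> pverts G \<and> v \<in> pverts G \<and> u \<noteq> v} =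
      {(i, j). i < card (pverts G) \<and> j < card (pverts G) \<and> i \<noteq> j}"
  proof -
    have "f ` pverts G = {..<card (pverts G)}" and inj: "inj_on f (pverts G)"
      using f by (auto simp: bij_betw_def)
    then have "i < card (pverts G) \<longleftrightarrow> (\<exists>u\<in>pverts G. i = f u)" for i
      by (metis imageE imageI lessThan_iff)
    then show ?thesis
      using inj by (auto simp: map_prod_def image_iff dest: inj_onD)
  qed
  ultimately show "graph_isomorphic G (complete_graph (card (pverts G)))"
    using f by (auto simp: graph_isomorphic_iff[OF pair_wf_digraph] complete_graph_def)
qed

lemma (in pair_graph) graph_isomorphic_edgeless_iff:
  "graph_isomorphic G (edgeless_graph (card (pverts G))) \<longleftrightarrow> parcs G = {}"
  using ex_bij_betw_finite_nat[OF pair_finite_verts]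
  by (auto simp: graph_isomorphic_iff[OF pair_wf_digraph] edgeless_graph_def atLeast0LessThan)

section \<open>Disjoint unions\<close>

lemma pverts_disjoint_union [simp]: "pverts (disjoint_union G H) = pverts G <+> pverts H"
  by (simp add: disjoint_union_def)

lemma parcs_disjoint_union_simps [simp]:
  "(Inl u, Inl v) \<in> parcs (disjoint_union G H) \<longleftrightarrow> (u, v) \<in> parcs G"
  "(Inr x, Inr y) \<in> parcs (disjoint_union G H) \<longleftrightarrow> (x, y) \<in> parcs H"
  "(Inl u, Inr y) \<notin> parcs (disjoint_union G H)"
  "(Inr x, Inl v) \<notin> parcs (disjoint_union G H)"
  by (auto simp: disjoint_union_def)

lemma parcs_disjoint_union_cases:
  assumes "(p, q) \<in> parcs (disjoint_union G H)"
  obtains u v where "p = Inl u" "q = Inl v" "(u, v) \<in> parcs G"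
  | u v where "p = Inr u" "q = Inr v" "(u, v) \<in> parcs H"
  using assms by (auto simp: disjoint_union_def)

lemma pair_graph_disjoint_union:
  assumes "pair_graph G" "pair_graph H"
  shows "pair_graph (disjoint_union G H)"
proof -
  interpret G: pair_graph G by fact
  interpret H: pair_graph H by fact
  show ?thesis
  proof unfold_locales
    show "symmetric (with_proj (disjoint_union G H))"
      unfolding symmetric_def with_proj_simps
      by (rule symI, erule parcs_disjoint_union_cases)
        (simp_all add: G.arcs_commute H.arcs_commute)
  qed (auto simp: disjoint_union_def G.pair_finite_verts H.pair_finite_verts
      G.pair_finite_arcs H.pair_finite_arcs
      dest: G.in_arcsD1 G.in_arcsD2 H.in_arcsD1 H.in_arcsD2 G.no_loops' H.no_loops')
qed

text \<open>A color-preserving automorphism \<pi> of \<open>G\<close> extends to the union by the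
  identity on \<open>H\<close>, as \<open>map_sum \<pi> id\<close>. Rigidity of the union makes the
  extension trivial, hence also \<pi>.\<close>

lemma distinguishing_labelling_Inl:
  assumes "distinguishing_labelling (disjoint_union G H) c"
  shows "distinguishing_labelling G (\<lambda>v. c (Inl v))"
proof (rule distinguishing_labellingI)
  show "c (Inl u) \<noteq> c (Inl v)" if "(u, v) \<in> parcs G" for u v
    using distinguishing_labelling_proper[OF assms] that by simp
  fix \<pi> v
  assume aut: "graph_automorphism G \<pi>"
    and pres: "\<And>u. u \<in> pverts G \<Longrightarrow> c (Inl (\<pi> u)) = c (Inl u)"
  from aut have \<pi>: "\<pi> permutes pverts G"
    by (simp add: graph_automorphism_def)
  have "map_sum \<pi> id permutes (pverts G <+> pverts H)"
  proof (rule bij_imp_permutes)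
    have "map_sum \<pi> id ` (pverts G <+> pverts H) = \<pi> ` pverts G <+> pverts H"
      by (force simp: image_iff)
    moreover have "inj_on (map_sum \<pi> id) (pverts G <+> pverts H)"
      using permutes_inj[OF \<pi>] by (auto simp: inj_on_def dest: injD)
    ultimately show "bij_betw (map_sum \<pi> id) (pverts G <+> pverts H) (pverts G <+> pverts H)"
      using permutes_image[OF \<pi>] by (simp add: bij_betw_def)
  next
    show "map_sum \<pi> id p = p" if "p \<notin> pverts G <+> pverts H" for p
      using that permutes_not_in[OF \<pi>] by (cases p) auto
  qed
  then have "graph_automorphism (disjoint_union G H) (map_sum \<pi> id)"
    using aut by (auto simp: graph_automorphism_def)
  then have "map_sum \<pi> id = (id :: 'a + 'b \<Rightarrow> 'a + 'b)"
    by (rule distinguishing_labelling_rigid[OF assms]) (auto simp: pres)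
  then have "map_sum \<pi> id (Inl v :: 'a + 'b) = Inl v"
    by simp
  then show "\<pi> v = v"
    by simp
qed

text \<open>An optimal labelling of the union is restricted to its left part. With
  \<open>H = G\<close> this is the lower bound in both the complete and the multipartite
  case.\<close>

lemma distinguishing_chromatic_number_disjoint_union_ge:
  assumes "pair_graph G" "pair_graph H"
  shows "\<chi>\<^sub>D G \<le> \<chi>\<^sub>D (disjoint_union G H)"
proof -
  interpret G: pair_graph G by fact
  interpret H: pair_graph H by fact
  interpret U: pair_graph "disjoint_union G H"
    using assms by (rule pair_graph_disjoint_union)
  obtain c :: "'a + 'b \<Rightarrow> ('a + 'b) set" where c: "distinguishing_labelling (disjoint_union G H) c"
    and card: "card (c ` (pverts G <+> pverts H)) = \<chi>\<^sub>D (disjoint_union G H)"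
    using U.distinguishing_chromatic_number_attained by auto
  have "\<chi>\<^sub>D G \<le> card ((\<lambda>v. c (Inl v)) ` pverts G)"
    using G.pair_finite_verts distinguishing_labelling_Inl[OF c]
    by (rule distinguishing_chromatic_number_le)
  also have "\<dots> \<le> card (c ` (pverts G <+> pverts H))"
    by (rule card_mono) (auto simp: G.pair_finite_verts H.pair_finite_verts)
  finally show ?thesis
    by (simp add: card)
qed

section \<open>Graphs with \<open>\<chi>\<^sub>D\<close> equal to the order\<close>

text \<open>Without arcs every transposition of two vertices is an automorphism, so two vertices of
  equal color could be exchanged. Applied to the union of two edgeless copies, this yields the value
  2n.\<close>

lemma (in pair_graph) distinguishing_chromatic_number_edgeless:
  assumes "parcs G = {}"
  shows "\<chi>\<^sub>D G = card (pverts G)"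
proof -
  obtain c :: "'a \<Rightarrow> 'a set" where c: "distinguishing_labelling G c"
    and card: "card (c ` pverts G) = \<chi>\<^sub>D G"
    by (rule distinguishing_chromatic_number_attained)
  have "inj_on c (pverts G)"
  proof (rule inj_onI)
    fix u v assume uv: "u \<in> pverts G" "v \<in> pverts G" "c u = c v"
    have "transpose u v = id"
    proof (rule distinguishing_labelling_rigid[OF c])
      show "graph_automorphism G (transpose u v)"
        using uv assms by (simp add: graph_automorphism_def permutes_swap_id)
    qed (use uv in \<open>simp add: transpose_def\<close>)
    then show "u = v"
      by (metis id_apply transpose_apply_first)
  qed
  then show ?thesis
    using card card_image by metis
qed

text \<open>If \<open>w\<close> were adjacent to \<open>u\<close> but not to \<open>v\<close>, then
  \<open>u\<close> and \<open>v\<close> could share a color: \<open>w\<close> is alone in its class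
  and therefore fixed, which prevents exchanging \<open>u\<close> with \<open>v\<close>. This would
  save a color.\<close>

lemma (in pair_graph) nonadjacent_imp_twins:
  assumes chi: "\<chi>\<^sub>D G = card (pverts G)"
    and uv: "u \<in> pverts G" "v \<in> pverts G" "u \<noteq> v" "(u, v) \<notin> parcs G"
    and uw: "(u, w) \<in> parcs G"
  shows "(v, w) \<in> parcs G"
proof (rule ccontr)
  assume vw: "(v, w) \<notin> parcs G"
  have w: "w \<in> pverts G" "w \<noteq> u" "w \<noteq> v"
    using uw uv(4) in_arcsD2 no_loops' by blast+
  \<comment> \<open>Each vertex is its own color, except that \<open>v\<close> takes the color of
    \<open>u\<close>; the color \<open>v\<close> becomes free.\<close>
  define c where "c = (\<lambda>x. if x = v then u else x)"
  have "distinguishing_labelling G c"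
  proof (rule distinguishing_labellingI)
    show "c x \<noteq> c y" if "(x, y) \<in> parcs G" for x y
      using that uv(4) arcs_commute no_loops'[OF that] by (auto simp: c_def)
    fix \<pi> x
    assume aut: "graph_automorphism G \<pi>" and pres: "\<And>y. y \<in> pverts G \<Longrightarrow> c (\<pi> y) = c y"
      and x: "x \<in> pverts G"
    have "\<pi> w = w"
      using pres[OF w(1)] w by (auto simp: c_def split: if_splits)
    then have "\<pi> u \<noteq> v"
      using graph_automorphism_arcs_iff[OF aut uv(1) w(1)] uw vw by auto
    then have u: "\<pi> u = u"
      using pres[OF uv(1)] by (auto simp: c_def split: if_splits)
    then have "\<pi> v \<noteq> u"
      using graph_automorphism_eq_iff[OF aut] uv(3) by metis
    then show "\<pi> x = x"
      using pres[OF x] u by (auto simp: c_def split: if_splits)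
  qed
  then have "\<chi>\<^sub>D G \<le> card (c ` pverts G)"
    using pair_finite_verts by (rule distinguishing_chromatic_number_le[rotated])
  also have "\<dots> \<le> card (pverts G - {v})"
    using pair_finite_verts uv by (intro card_mono) (auto simp: c_def)
  also have "\<dots> < card (pverts G)"
    using uv(2) pair_finite_verts by (rule card_Diff1_less[rotated])
  finally show False
    using chi by simp
qed

text \<open>The extra color needs a vertex to sit on: for the empty graph both chromatic numbers are
  0.\<close>

lemma (in pair_graph) distinguishing_chromatic_number_two_complete:
  assumes chi: "\<chi>\<^sub>D G = card (pverts G)" and nonempty: "pverts G \<noteq> {}"
    and complete: "\<And>u v. u \<in> pverts G \<Longrightarrow> v \<in> pverts G \<Longrightarrow> u \<noteq> v \<Longrightarrow> (u, v) \<in> parcs G"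
  shows "\<chi>\<^sub>D (disjoint_union G G) = card (pverts G) + 1"
proof -
  let ?U = "disjoint_union G G" and ?V = "pverts G"
  interpret U: pair_graph ?U
    by (rule pair_graph_disjoint_union) unfold_locales
  obtain a where a: "a \<in> ?V"
    using nonempty by blast
  \<comment> \<open>\<open>None\<close> is the extra color, carried by \<open>Inr a\<close> alone.
    This leaves \<open>Some a\<close> to \<open>Inl a\<close> alone, so both copies of
    \<open>a\<close> are fixed, while every other color is shared by the two copies of one
    vertex.\<close>
  define d where "d = case_sum Some (\<lambda>v. if v = a then None else Some v)"
  have "distinguishing_labelling ?U d"
  proof (rule distinguishing_labellingI)
    show "d p \<noteq> d q" if "(p, q) \<in> parcs ?U" for p q
      using that by (rule parcs_disjoint_union_cases) (auto simp: d_def dest: no_loops')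
    fix \<pi> p
    assume aut: "graph_automorphism ?U \<pi>" and pres: "\<And>q. q \<in> pverts ?U \<Longrightarrow> d (\<pi> q) = d q"
      and p: "p \<in> pverts ?U"
    have d_eq: "d q = Some v \<longleftrightarrow> q = Inl v \<or> q = Inr v \<and> v \<noteq> a"
      "d q = None \<longleftrightarrow> q = Inr a" for q v
      by (auto simp: d_def split: sum.splits if_splits)
    have fix_a: "\<pi> (Inl a) = Inl a" "\<pi> (Inr a) = Inr a"
      using pres[of "Inl a"] pres[of "Inr a"] a d_eq by (auto simp: d_def)
    \<comment> \<open>By completeness \<open>Inl v\<close> is adjacent to the fixed vertex
      \<open>Inl a\<close>, so its image stays in the left copy. Injectivity of \<pi> then fixes the
      right copy as well.\<close>
    have fix_Inl: "\<pi> (Inl v) = Inl v" if "v \<in> ?V" for v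
    proof (cases "v = a")
      case False
      then have "(\<pi> (Inl v), \<pi> (Inl a)) \<in> parcs ?U"
        using graph_automorphism_arcs_iff[OF aut, of "Inl v" "Inl a"] that a complete by auto
      moreover have "\<pi> (Inl v) = Inl v \<or> \<pi> (Inl v) = Inr v"
        using pres[of "Inl v"] that d_eq by (auto simp: d_def)
      ultimately show ?thesis
        using fix_a by auto
    qed (use fix_a in simp)
    have "\<pi> (Inr v) = Inr v" if "v \<in> ?V" for v
    proof (cases "v = a")
      case False
      then have "\<pi> (Inr v) = Inl v \<or> \<pi> (Inr v) = Inr v"
        using pres[of "Inr v"] that d_eq by (auto simp: d_def)
      then show ?thesis
        using graph_automorphism_eq_iff[OF aut, of "Inr v" "Inl v"] fix_Inl[OF that] by auto
    qed (use fix_a in simp)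
    then show "\<pi> p = p"
      using p fix_Inl by auto
  qed
  then have "\<chi>\<^sub>D ?U \<le> card (d ` pverts ?U)"
    by (rule distinguishing_chromatic_number_le[OF U.pair_finite_verts])
  also have "\<dots> \<le> card (insert None (Some ` ?V))"
    by (rule card_mono) (auto simp: d_def pair_finite_verts split: if_splits)
  also have "\<dots> = card ?V + 1"
    using pair_finite_verts by (simp add: card_image)
  finally have upper: "\<chi>\<^sub>D ?U \<le> card ?V + 1" .

  \<comment> \<open>With only n colors, \<open>l\<close> and \<open>r\<close> are injective by
    completeness and thus both exhaust the colors. Matching vertices of equal color gives a
    nontrivial automorphism.\<close>
  have "\<chi>\<^sub>D ?U \<noteq> card ?V"
  proof
    assume eq: "\<chi>\<^sub>D ?U = card ?V"
    obtain c :: "'a + 'a \<Rightarrow> ('a + 'a) set" where c: "distinguishing_labelling ?U c"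
      and card: "card (c ` pverts ?U) = card ?V"
      using U.distinguishing_chromatic_number_attained eq by metis
    define l where "l = (\<lambda>v. c (Inl v))"
    define r where "r = (\<lambda>v. c (Inr v))"
    have "l u \<noteq> l v" "r u \<noteq> r v" if "u \<in> ?V" "v \<in> ?V" "u \<noteq> v" for u v
      using complete[OF that] distinguishing_labelling_proper[OF c] by (simp_all add: l_def r_def)
    then have inj: "inj_on l ?V" "inj_on r ?V"
      by (auto simp: inj_on_def)
    have "finite (c ` pverts ?U)"
      using U.pair_finite_verts by simp
    moreover have "l ` ?V \<subseteq> c ` pverts ?U" "r ` ?V \<subseteq> c ` pverts ?U"
      by (auto simp: l_def r_def)
    ultimately have "l ` ?V = c ` pverts ?U" "r ` ?V = c ` pverts ?U"
      using card card_image[OF inj(1)] card_image[OF inj(2)] by (metis card_subset_eq)+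
    then have img: "l ` ?V = r ` ?V"
      by simp
    \<comment> \<open>\<open>f\<close> sends a vertex of the left copy to the one of the same color
      in the right copy; \<open>g\<close> is its inverse.\<close>
    define f where "f = (\<lambda>v. inv_into ?V r (l v))"
    define g where "g = (\<lambda>v. inv_into ?V l (r v))"
    have f: "f v \<in> ?V" "r (f v) = l v" "g (f v) = v" if "v \<in> ?V" for v
    proof -
      have "l v \<in> r ` ?V"
        using that img by blast
      then show "f v \<in> ?V" and *: "r (f v) = l v"
        by (auto simp: f_def inv_into_into f_inv_into_f)
      show "g (f v) = v"
        using that inj by (simp add: g_def * inv_into_f_f)
    qed
    have g: "g v \<in> ?V" "l (g v) = r v" "f (g v) = v" if "v \<in> ?V" for v
    proof -
      have "r v \<in> l ` ?V"
        using that img by blast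
      then show "g v \<in> ?V" and *: "l (g v) = r v"
        by (auto simp: g_def inv_into_into f_inv_into_f)
      show "f (g v) = v"
        using that inj by (simp add: f_def * inv_into_f_f)
    qed
    \<comment> \<open>\<pi> exchanges the copies along the colors and is the identity off the vertex
      set, as \<open>permutes\<close> demands. It is an involution, hence a bijection, and it
      respects arcs because adjacency within a copy is just inequality.\<close>
    define \<pi> where "\<pi> = case_sum (\<lambda>v. if v \<in> ?V then Inr (f v) else Inl v)
      (\<lambda>v. if v \<in> ?V then Inl (g v) else Inr v)"
    have "\<pi> (\<pi> p) = p" for p
      by (cases p) (simp_all add: \<pi>_def f g)
    then have "\<exists>!q. \<pi> q = p" for p
      by metis
    moreover have "\<pi> p = p" if "p \<notin> pverts ?U" for p
      using that by (cases p) (auto simp: \<pi>_def)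
    ultimately have "\<pi> permutes pverts ?U"
      by (simp add: permutes_def)
    moreover have "(\<pi> p, \<pi> q) \<in> parcs ?U \<longleftrightarrow> (p, q) \<in> parcs ?U"
      if "p \<in> pverts ?U" "q \<in> pverts ?U" for p q
    proof -
      have adj: "(u, v) \<in> parcs G \<longleftrightarrow> u \<noteq> v" if "u \<in> ?V" "v \<in> ?V" for u v
        using that complete no_loops' by blast
      have "f u = f v \<longleftrightarrow> u = v" "g u = g v \<longleftrightarrow> u = v" if "u \<in> ?V" "v \<in> ?V" for u v
        using that f(3) g(3) by metis+
      then show ?thesis
        using that by (cases p; cases q) (auto simp: \<pi>_def adj f(1) g(1))
    qed
    ultimately have "graph_automorphism ?U \<pi>"
      by (simp add: graph_automorphism_def)
    moreover have "c (\<pi> p) = c p" if "p \<in> pverts ?U" for p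
      using that f(2) g(2) by (auto simp: \<pi>_def l_def r_def)
    ultimately have "\<pi> = id"
      by (rule distinguishing_labelling_rigid[OF c])
    then have "\<pi> (Inl a) = Inl a"
      by simp
    then show False
      using a by (simp add: \<pi>_def)
  qed
  moreover have "card ?V \<le> \<chi>\<^sub>D ?U"
    using distinguishing_chromatic_number_disjoint_union_ge[of G G] chi pair_graph_axioms
    by simp
  ultimately show ?thesis
    using upper by simp
qed

lemma (in pair_graph) distinguishing_chromatic_number_two_multipartite:
  assumes chi: "\<chi>\<^sub>D G = card (pverts G)"
    and ab: "a \<in> pverts G" "b \<in> pverts G" "a \<noteq> b" "(a, b) \<notin> parcs G"
    and edge: "(x, y) \<in> parcs G"
  shows "\<chi>\<^sub>D (disjoint_union G G) = card (pverts G)"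
proof -
  let ?U = "disjoint_union G G" and ?V = "pverts G"
  interpret U: pair_graph ?U
    by (rule pair_graph_disjoint_union) unfold_locales
  \<comment> \<open>If \<open>a\<close> is \<open>x\<close>, take \<open>y\<close>; if
    \<open>a\<close> is adjacent to \<open>x\<close>, take \<open>x\<close>; otherwise
    \<open>a\<close> is a twin of \<open>x\<close> and so adjacent to \<open>y\<close>.\<close>
  obtain c where ac: "(a, c) \<in> parcs G"
    using nonadjacent_imp_twins[OF chi, of x a y] edge ab(1) in_arcsD1 arcs_commute by blast
  then have c: "c \<in> ?V" "c \<noteq> a" "c \<noteq> b"
    using ab in_arcsD2 no_loops' by blast+
  define \<sigma> where "\<sigma> = transpose b c"
  have \<sigma>: "\<sigma> a = a" "\<sigma> c = b" "\<And>v. \<sigma> (\<sigma> v) = v" "\<And>v. v \<in> ?V \<Longrightarrow> \<sigma> v \<in> ?V"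
    using ab c by (auto simp: \<sigma>_def transpose_def)
  \<comment> \<open>Both copies use the vertices of \<open>G\<close> as colors, with
    \<open>b\<close> and \<open>c\<close> interchanged on the right. As \<sigma> is an involution,
    color \<open>v\<close> belongs to exactly \<open>Inl v\<close> and
    \<open>Inr (\<sigma> v)\<close>.\<close>
  define d where "d = case_sum id \<sigma>"
  have d_eq: "d p = v \<longleftrightarrow> p = Inl v \<or> p = Inr (\<sigma> v)" for p v
    using \<sigma>(3) by (auto simp: d_def split: sum.splits)
  have "distinguishing_labelling ?U d"
  proof (rule distinguishing_labellingI)
    show "d p \<noteq> d q" if "(p, q) \<in> parcs ?U" for p q
      using that
    proof (rule parcs_disjoint_union_cases)
      fix u v assume uv: "p = Inr u" "q = Inr v" "(u, v) \<in> parcs G"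
      then have "\<sigma> u \<noteq> \<sigma> v"
        using no_loops' \<sigma>(3) by metis
      then show "d p \<noteq> d q"
        using uv by (simp add: d_def)
    qed (auto simp: d_def dest: no_loops')
    fix \<pi> p
    assume aut: "graph_automorphism ?U \<pi>" and pres: "\<And>q. q \<in> pverts ?U \<Longrightarrow> d (\<pi> q) = d q"
      and p: "p \<in> pverts ?U"
    have Inl_cases: "\<pi> (Inl v) = Inl v \<or> \<pi> (Inl v) = Inr (\<sigma> v)" if "v \<in> ?V" for v
      using pres[of "Inl v"] that d_eq by (auto simp: d_def)
    have Inr_cases: "\<pi> (Inr v) = Inl (\<sigma> v) \<or> \<pi> (Inr v) = Inr v" if "v \<in> ?V" for v
      using pres[of "Inr v"] that d_eq \<sigma>(3) by (auto simp: d_def)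
    have arc: "(\<pi> (Inl u), \<pi> (Inl v)) \<in> parcs ?U" if "(u, v) \<in> parcs G" for u v
      using graph_automorphism_arcs_iff[OF aut, of "Inl u" "Inl v"] that in_arcsD1 in_arcsD2
      by auto
    \<comment> \<open>Otherwise \<open>Inl a\<close> goes to \<open>Inr a\<close>, while
      \<open>Inl c\<close> goes to \<open>Inl c\<close> or \<open>Inr b\<close>. Neither is adjacent
      to \<open>Inr a\<close>, although \<open>a\<close> and \<open>c\<close> are adjacent.\<close>
    have a: "\<pi> (Inl a) = Inl a"
      using arc[OF ac] Inl_cases[OF ab(1)] Inl_cases[OF c(1)] \<sigma> ab(4) by auto
    then have c': "\<pi> (Inl c) = Inl c"
      using arc[OF ac] Inl_cases[OF c(1)] by auto
    \<comment> \<open>A vertex other than \<open>a\<close> is adjacent to \<open>a\<close>, or is a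
      twin of \<open>a\<close> and so adjacent to \<open>c\<close>. Either way it has a fixed
      neighbour in the left copy and cannot leave that copy.\<close>
    have fix_Inl: "\<pi> (Inl v) = Inl v" if v: "v \<in> ?V" for v
    proof -
      have "v = a \<or> (a, v) \<in> parcs G \<or> (v, c) \<in> parcs G"
        using nonadjacent_imp_twins[OF chi ab(1) v _ _ ac] by blast
      then show ?thesis
        using a c' arc[of a v] arc[of v c] Inl_cases[OF v] by auto
    qed
    \<comment> \<open>The only other candidate, \<open>Inl (\<sigma> v)\<close>, is already its own
      image.\<close>
    have "\<pi> (Inr v) = Inr v" if "v \<in> ?V" for v
      using Inr_cases[OF that] fix_Inl[OF \<sigma>(4)[OF that]]
        graph_automorphism_eq_iff[OF aut, of "Inr v" "Inl (\<sigma> v)"] by auto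
    then show "\<pi> p = p"
      using p fix_Inl by auto
  qed
  then have "\<chi>\<^sub>D ?U \<le> card (d ` pverts ?U)"
    by (rule distinguishing_chromatic_number_le[OF U.pair_finite_verts])
  also have "\<dots> \<le> card ?V"
    by (rule card_mono) (auto simp: d_def pair_finite_verts \<sigma>(4))
  finally show ?thesis
    using distinguishing_chromatic_number_disjoint_union_ge[of G G] chi pair_graph_axioms
    by simp
qed

text \<open>For n = 1 the graph is both complete and edgeless, and the two values agree since n + 1
  = 2n. For n = 0 they would conflict, so the vertex set is taken to be non-empty.\<close>

theorem theorem5p8:
  fixes G :: "'a pair_pre_digraph" and n :: nat
  assumes "pair_graph G"
    and "pverts G \<noteq> {}"
    and "card (pverts G) = n"
    and "\<chi>\<^sub>D G = n"
  shows "(graph_isomorphic G (complete_graph n) \<longrightarrow> \<chi>\<^sub>D (disjoint_union G G) = n + 1)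
    \<and> (graph_isomorphic G (edgeless_graph n) \<longrightarrow> \<chi>\<^sub>D (disjoint_union G G) = 2 * n)
    \<and> (\<not> graph_isomorphic G (complete_graph n) \<and> \<not> graph_isomorphic G (edgeless_graph n)
         \<longrightarrow> \<chi>\<^sub>D (disjoint_union G G) = n)"
proof -
  interpret pair_graph G by fact
  interpret U: pair_graph "disjoint_union G G"
    using assms(1) assms(1) by (rule pair_graph_disjoint_union)
  have chi: "\<chi>\<^sub>D G = card (pverts G)"
    using assms by simp
  have complete: "graph_isomorphic G (complete_graph n) \<longleftrightarrow>
      (\<forall>u\<in>pverts G. \<forall>v\<in>pverts G. u \<noteq> v \<longrightarrow> (u, v) \<in> parcs G)"
    using graph_isomorphic_complete_iff assms(3) by simp
  have edgeless: "graph_isomorphic G (edgeless_graph n) \<longleftrightarrow> parcs G = {}"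
    using graph_isomorphic_edgeless_iff assms(3) by simp
  have "\<chi>\<^sub>D (disjoint_union G G) = n + 1" if "graph_isomorphic G (complete_graph n)"
    using distinguishing_chromatic_number_two_complete[OF chi assms(2)] that assms(3)
    by (auto simp: complete)
  moreover have "\<chi>\<^sub>D (disjoint_union G G) = 2 * n" if "graph_isomorphic G (edgeless_graph n)"
  proof -
    have "parcs (disjoint_union G G) = {}"
      using that by (simp add: edgeless disjoint_union_def)
    then show ?thesis
      using U.distinguishing_chromatic_number_edgeless pair_finite_verts assms(3)
      by (simp add: card_Plus)
  qed
  moreover have "\<chi>\<^sub>D (disjoint_union G G) = n"
    if not_complete: "\<not> graph_isomorphic G (complete_graph n)"
      and not_edgeless: "\<not> graph_isomorphic G (edgeless_graph n)"
  proof -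
    obtain a b where "a \<in> pverts G" "b \<in> pverts G" "a \<noteq> b" "(a, b) \<notin> parcs G"
      using not_complete complete by blast
    moreover obtain x y where "(x, y) \<in> parcs G"
      using not_edgeless edgeless by fastforce
    ultimately show ?thesis
      using distinguishing_chromatic_number_two_multipartite[OF chi] assms(3) by blast
  qed
  ultimately show ?thesis
    by blast
qed

end
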